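(* Let $j \in \mathbb{N}_0$ and $r \in \mathbb{Z}$. Then: (a) $c_j^{(r+1)} = c_{j+1}^{(r)} + c_j^{(r)}$ as arithmetic functions; (b) if $n = p_1^{a_1} p_2^{a_2} \cdots p_\nu^{a_\nu}$ with distinct primes $p_1, \dots, p_\nu$ and $a_1,\dots,a_\nu \in \mathbb{N}$, then $$c_j^{(r)}(n) = \sum_{k=0}^{j} (-1)^k \binom{j}{k} \prod_{l=1}^{\nu} \binom{a_l + r + j - k - 1}{a_l}.$$
   Context: Arithmetic functions are maps $\mathbb{N} \to \mathbb{C}$ with Dirichlet convolution $(f*g)(n) = \sum_{n_1 n_2 = n} f(n_1) g(n_2)$. Write $f^{*j}$ for the $j$-fold convolution power, with $f^{*0} = e$, where $e(n) = \delta_{n,1}$ is the neutral element. Let $1$ denote the constant function $1$ and $\mu$ the Möbius function, its convolution inverse; for negative integers $-r$ set $1^{*(-r)} = \mu^{*r}$. For $j \in \mathbb{N}_0$ and $r \in \mathbb{Z}$, the associated $(j,r)$-divisor function is $c_j^{(r)} = (1-e)^{*j} * 1^{*r}$ (for $r\ge 0$ it counts ordered factorisations of $n$ into $j+r$ factors, the first $j$ of which are $>1$). Binomial coefficients $\binom{x}{a}$ with integer (possibly negative) upper entry $x$ and $a \in \mathbb{N}_0$ are the generalized ones $x(x-1)\cdots(x-a+1)/a!$. *)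

theory Defs
  imports Complex_Main "HOL-Computational_Algebra.Computational_Algebra"
begin

text \<open>
  An arithmetic function is represented by a function of type \<open>nat \<Rightarrow> complex\<close>. Its argument
  ranges over the positive integers; the value at \<open>0\<close> is meaningless, so identities between
  arithmetic functions are stated for positive arguments only. For positive \<open>n\<close> the
  factorisations in \<open>dirichlet_conv\<close> form a finite set and never involve the argument \<open>0\<close>.
\<close>

definition dirichlet_conv ::
    "(nat \<Rightarrow> complex) \<Rightarrow> (nat \<Rightarrow> complex) \<Rightarrow> nat \<Rightarrow> complex"  (infixl "\<star>" 70)
  where "(f \<star> g) n = (\<Sum>(n1, n2) | n1 * n2 = n. f n1 * g n2)"

definition arith_unit :: "nat \<Rightarrow> complex"
  where "arith_unit n = (if n = 1 then 1 else 0)"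

definition arith_one :: "nat \<Rightarrow> complex"
  where "arith_one n = 1"

definition moebius :: "nat \<Rightarrow> complex"
  where "moebius n = (if squarefree n then (- 1) ^ card (prime_factors n) else 0)"

primrec conv_power :: "(nat \<Rightarrow> complex) \<Rightarrow> nat \<Rightarrow> nat \<Rightarrow> complex"
  where
    "conv_power f 0 = arith_unit"
  | "conv_power f (Suc j) = f \<star> conv_power f j"

definition one_conv_power :: "int \<Rightarrow> nat \<Rightarrow> complex"
  where "one_conv_power r =
    (if r \<ge> 0 then conv_power arith_one (nat r) else conv_power moebius (nat (- r)))"

definition assoc_divisor_fun :: "nat \<Rightarrow> int \<Rightarrow> nat \<Rightarrow> complex"
  where "assoc_divisor_fun j r =
    conv_power (\<lambda>n. arith_one n - arith_unit n) j \<star> one_conv_power r"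

end

theory Submission
  imports Defs
begin

text \<open>
  Let \<open>h s\<close> (below: \<open>divisor_prod s\<close>) be the multiplicative function with value \<open>(a + s - 1) gchoose a\<close> at every prime power
  \<open>p ^ a\<close>. The parallel summation identity for binomial coefficients gives \<open>1 \<star> h s = h (s + 1)\<close>
  for every integer \<open>s\<close>, and \<open>h 0\<close> is the unit while \<open>h (-1)\<close> is the Moebius function. Hence
  Moebius inversion is the case \<open>s = -1\<close>, and \<open>h r\<close> is the \<open>r\<close>-th convolution power of \<open>1\<close> also for
  negative \<open>r\<close>. Part (a) is distributivity; read as a difference equation in \<open>r\<close>, it yields (b) by
  iterated differences.
\<close>

section \<open>Algebra of Dirichlet convolution\<close>

lemma finite_nat_factorisations: "n > 0 \<Longrightarrow> finite {(a, b). a * b = (n :: nat)}"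
  by (rule finite_subset[of _ "{..n} \<times> {..n}"]) auto

text \<open>A sum over an infinite set is \<open>0\<close> by convention, so every convolution
  vanishes at \<open>0\<close>, and its laws can be stated as equalities of functions.\<close>

lemma infinite_factorisations_0: "infinite {(a, b). a * b = (0 :: nat)}"
proof
  assume "finite {(a, b). a * b = (0 :: nat)}"
  moreover have "range (\<lambda>a :: nat. (a, 0 :: nat)) \<subseteq> {(a, b). a * b = 0}"
    by auto
  ultimately have "finite (range (\<lambda>a :: nat. (a, 0 :: nat)))"
    by (rule finite_subset[rotated])
  then show False
    using finite_imageD[of "\<lambda>a :: nat. (a, 0 :: nat)" UNIV] by (auto simp: inj_on_def)
qed

lemma dirichlet_conv_0 [simp]: "(f \<star> g) 0 = 0"
  using infinite_factorisations_0 by (simp add: dirichlet_conv_def)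

lemma dirichlet_conv_commute: "f \<star> g = g \<star> f"
proof
  fix n
  show "(f \<star> g) n = (g \<star> f) n"
    unfolding dirichlet_conv_def
    by (rule sum.reindex_bij_witness[of _ prod.swap prod.swap]) (auto simp: mult.commute)
qed

text \<open>Both sides sum \<open>f a * g b * h c\<close> over all triples with product
  \<open>n\<close>; they differ only in the pair that is grouped first.\<close>

lemma dirichlet_conv_assoc: "(f \<star> g) \<star> h = f \<star> (g \<star> h)"
proof
  fix n
  show "((f \<star> g) \<star> h) n = (f \<star> (g \<star> h)) n"
  proof (cases "n > 0")
    case True
    \<comment> \<open>Exchanging nested sums with a sum over pairs needs finite fibres; factors of a
      positive \<open>n\<close> are positive.\<close>
    have fin: "finite {(a, b). a * b = m}" if "m * k = n \<or> k * m = n" for m k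
      by (rule finite_nat_factorisations) (use True that in \<open>auto intro!: gr0I\<close>)
    let ?A = "SIGMA x:{(m, c). m * c = n}. {(a, b). a * b = fst x}"
    let ?B = "SIGMA x:{(a, m). a * m = n}. {(b, c). b * c = snd x}"
    have "((f \<star> g) \<star> h) n = (\<Sum>x\<in>{(m, c). m * c = n}. \<Sum>y\<in>{(a, b). a * b = fst x}.
            f (fst y) * g (snd y) * h (snd x))"
      by (simp add: dirichlet_conv_def sum_distrib_right case_prod_unfold)
    also have "\<dots> = (\<Sum>(x, y)\<in>?A. f (fst y) * g (snd y) * h (snd x))"
      by (rule sum.Sigma) (use fin finite_nat_factorisations[OF True] in auto)
    also have "\<dots> = (\<Sum>(x, y)\<in>?B. f (fst x) * (g (fst y) * h (snd y)))"
      by (rule sum.reindex_bij_witness[of _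
            "\<lambda>((a, m), (b, c)). ((a * b, c), (a, b))" "\<lambda>((m, c), (a, b)). ((a, b * c), (b, c))"])
         (auto simp: mult_ac)
    also have "\<dots> = (\<Sum>x\<in>{(a, m). a * m = n}. \<Sum>y\<in>{(b, c). b * c = snd x}.
            f (fst x) * (g (fst y) * h (snd y)))"
      by (rule sum.Sigma [symmetric]) (use fin finite_nat_factorisations[OF True] in auto)
    also have "\<dots> = (f \<star> (g \<star> h)) n"
      by (simp add: dirichlet_conv_def sum_distrib_left case_prod_unfold)
    finally show ?thesis .
  qed simp
qed

lemma dirichlet_conv_diff_left: "(\<lambda>n. f n - g n) \<star> h = (\<lambda>n. (f \<star> h) n - (g \<star> h) n)"
  by (simp add: dirichlet_conv_def fun_eq_iff case_prod_unfold left_diff_distrib sum_subtractf)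

text \<open>The assumption covers the argument \<open>0\<close>, where the convolution is
  \<open>0\<close>.\<close>

lemma arith_unit_conv_left:
  assumes "f 0 = 0"
  shows "arith_unit \<star> f = f"
proof
  fix n
  show "(arith_unit \<star> f) n = f n"
  proof (cases "n > 0")
    case True
    have "(arith_unit \<star> f) n = (\<Sum>(a, b)\<in>{(1, n)}. arith_unit a * f b)"
      unfolding dirichlet_conv_def
      by (rule sum.mono_neutral_right)
         (use finite_nat_factorisations[OF True] in \<open>auto simp: arith_unit_def split: if_splits\<close>)
    then show ?thesis
      by (simp add: arith_unit_def)
  qed (use assms in simp)
qed

lemma arith_one_conv:
  assumes "n > 0"
  shows "(arith_one \<star> f) n = (\<Sum>d | d dvd n. f d)"
  unfolding dirichlet_conv_def
  by (rule sum.reindex_bij_witness[of _ "\<lambda>d. (n div d, d)" snd])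
     (use assms in \<open>auto simp: arith_one_def\<close>)

section \<open>The family \<open>divisor_prod\<close> and its shift under convolution with 1\<close>

text \<open>The value \<open>0\<close> at \<open>0\<close> matches the junk value of \<open>\<star>\<close> there, so identities hold as functions.\<close>

definition divisor_prod :: "int \<Rightarrow> nat \<Rightarrow> complex"
  where "divisor_prod s n = (if n = 0 then 0 else
    (\<Prod>p\<in>prime_factors n. (of_nat (multiplicity p n) + of_int s - 1) gchoose multiplicity p n))"

lemma multiplicity_eq_0_if_not_prime_factor:
  fixes d :: nat
  assumes "d > 0" "p \<notin> prime_factors d" "p \<in> prime_factors n"
  shows "multiplicity p d = 0"
  using assms by (auto simp: prime_factors_dvd intro: not_dvd_imp_multiplicity_0)

text \<open>Expanding the product of sums selects an exponent \<open>g p\<close> between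
  \<open>0\<close> and \<open>multiplicity p n\<close> for each prime factor of \<open>n\<close>; by
  unique factorisation these selections are exactly the divisors.\<close>

lemma sum_divisors_prod_multiplicity:
  fixes F :: "nat \<Rightarrow> nat \<Rightarrow> 'a :: comm_semiring_1"
  assumes "n > 0"
  shows "(\<Sum>d | d dvd n. \<Prod>p\<in>prime_factors n. F p (multiplicity p d)) =
         (\<Prod>p\<in>prime_factors n. \<Sum>i\<le>multiplicity p n. F p i)"
proof -
  let ?P = "prime_factors n"
  let ?G = "Pi\<^sub>E ?P (\<lambda>p. {..multiplicity p n})"
  have prP: "prime p" if "p \<in> ?P" for p
    using that by (rule in_prime_factors_imp_prime)
  have mult: "multiplicity q (\<Prod>p\<in>?P. p ^ g p) = (if q \<in> ?P then g q else 0)"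
    if "prime q" for g q
    by (rule multiplicity_prod_prime_powers) (use that in auto)
  have pos: "(\<Prod>p\<in>?P. p ^ g p) \<noteq> 0" for g
    using prP by (auto dest: prime_gt_0_nat)
  have "(\<Prod>p\<in>?P. \<Sum>i\<le>multiplicity p n. F p i) = (\<Sum>g\<in>?G. \<Prod>p\<in>?P. F p (g p))"
    by (rule prod_sum_PiE) auto
  also have "\<dots> = (\<Sum>d | d dvd n. \<Prod>p\<in>?P. F p (multiplicity p d))"
  proof (rule sum.reindex_bij_witness[of _
            "\<lambda>d. restrict (\<lambda>p. multiplicity p d) ?P" "\<lambda>g. \<Prod>p\<in>?P. p ^ g p"])
    fix g assume g: "g \<in> ?G"
    show "restrict (\<lambda>p. multiplicity p (\<Prod>p\<in>?P. p ^ g p)) ?P = g"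
    proof
      fix q
      show "restrict (\<lambda>p. multiplicity p (\<Prod>p\<in>?P. p ^ g p)) ?P q = g q"
        by (cases "q \<in> ?P") (simp_all add: mult[OF prP] PiE_arb[OF g])
    qed
    show "(\<Prod>p\<in>?P. p ^ g p) \<in> {d. d dvd n}"
      using PiE_mem[OF g] pos[of g] multiplicity_le_imp_dvd[of "\<Prod>p\<in>?P. p ^ g p" n]
      by (simp add: mult)
    show "(\<Prod>p\<in>?P. F p (multiplicity p (\<Prod>p\<in>?P. p ^ g p))) = (\<Prod>p\<in>?P. F p (g p))"
      by (rule prod.cong) (simp_all add: mult[OF prP])
  next
    fix d assume d: "d \<in> {d. d dvd n}"
    then have d0: "d \<noteq> 0" using assms by auto
    show "restrict (\<lambda>p. multiplicity p d) ?P \<in> ?G"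
      using d assms by (auto intro!: dvd_imp_multiplicity_le)
    have "(\<Prod>p\<in>?P. p ^ restrict (\<lambda>p. multiplicity p d) ?P p) = (\<Prod>p\<in>?P. p ^ multiplicity p d)"
      by (rule prod.cong) simp_all
    also have "\<dots> = (\<Prod>p\<in>prime_factors d. p ^ multiplicity p d)"
      by (rule prod.mono_neutral_right)
         (use d assms dvd_prime_factors[of n d] in
            \<open>auto simp: multiplicity_eq_0_if_not_prime_factor\<close>)
    also have "\<dots> = d"
      using d0 by (simp add: prime_factorization_nat[symmetric])
    finally show "(\<Prod>p\<in>?P. p ^ restrict (\<lambda>p. multiplicity p d) ?P p) = d" .
  qed
  finally show ?thesis ..
qed

text \<open>The divisor sum factors over the primes of \<open>n\<close>, which leaves a binomial
  identity at each prime.\<close>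

lemma arith_one_conv_divisor_prod: "arith_one \<star> divisor_prod s = divisor_prod (s + 1)"
proof
  fix n
  show "(arith_one \<star> divisor_prod s) n = divisor_prod (s + 1) n"
  proof (cases "n > 0")
    case True
    define F :: "nat \<Rightarrow> complex" where "F i = (of_nat i + of_int s - 1) gchoose i" for i
    have sum_F: "(\<Sum>i\<le>k. F i) = (of_nat k + of_int (s + 1) - 1) gchoose k" for k
      using gbinomial_parallel_sum[of "of_int s - 1 :: complex" k]
      by (simp add: F_def algebra_simps)
    have "(arith_one \<star> divisor_prod s) n = (\<Sum>d | d dvd n. divisor_prod s d)"
      using True by (rule arith_one_conv)
    \<comment> \<open>All products are taken over the primes of \<open>n\<close>, the same set for
      every \<open>d\<close>; a prime not dividing \<open>d\<close> contributes
      \<open>F 0 = 1\<close>.\<close>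
    also have "\<dots> = (\<Sum>d | d dvd n. \<Prod>p\<in>prime_factors n. F (multiplicity p d))"
    proof (rule sum.cong)
      fix d assume "d \<in> {d. d dvd n}"
      then have d: "d dvd n" "d \<noteq> 0" using True by auto
      have "(\<Prod>p\<in>prime_factors d. F (multiplicity p d)) =
            (\<Prod>p\<in>prime_factors n. F (multiplicity p d))"
        by (rule prod.mono_neutral_left)
           (use d True dvd_prime_factors[of n d] in
              \<open>auto simp: F_def multiplicity_eq_0_if_not_prime_factor\<close>)
      then show "divisor_prod s d = (\<Prod>p\<in>prime_factors n. F (multiplicity p d))"
        using d by (simp add: divisor_prod_def F_def)
    qed simp
    also have "\<dots> = (\<Prod>p\<in>prime_factors n. \<Sum>i\<le>multiplicity p n. F i)"
      using True by (rule sum_divisors_prod_multiplicity)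
    also have "\<dots> = divisor_prod (s + 1) n"
      using True by (simp add: divisor_prod_def sum_F)
    finally show ?thesis .
  qed (simp add: divisor_prod_def)
qed

section \<open>The unit, the Moebius function and convolution powers of 1\<close>

lemma divisor_prod_0: "divisor_prod 0 = arith_unit"
proof
  fix n
  show "divisor_prod 0 n = arith_unit n"
  proof (cases "n > 1")
    case True
    then obtain p where p: "p \<in> prime_factors n"
      by (metis prime_factor_nat in_prime_factors_iff less_irrefl not_less0)
    then have "multiplicity p n > 0"
      by (auto simp: prime_factors_multiplicity)
    then obtain k where "multiplicity p n = Suc k"
      using gr0_implies_Suc by blast
    \<comment> \<open>The upper entry is the natural number \<open>k\<close>, which lies below the
      lower entry \<open>Suc k\<close>.\<close>
    then have "((of_nat (multiplicity p n) - 1 :: complex) gchoose multiplicity p n) = 0"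
      by (simp flip: binomial_gbinomial)
    then have "(\<Prod>p\<in>prime_factors n. (of_nat (multiplicity p n) - 1 :: complex) gchoose multiplicity p n) = 0"
      using p by (intro prod_zero) auto
    then show ?thesis
      using True by (simp add: divisor_prod_def arith_unit_def)
  next
    case False
    then have "n = 0 \<or> n = 1" by auto
    then show ?thesis
      by (auto simp: divisor_prod_def arith_unit_def)
  qed
qed

lemma gbinomial_minus_2:
  "((of_nat k - 2 :: complex) gchoose k) = (if k = 0 then 1 else if k = 1 then -1 else 0)"
proof (cases "k \<ge> 2")
  case True
  then obtain m where "k = m + 2"
    by (metis add.commute le_Suc_ex)
  then show ?thesis
    by (simp flip: binomial_gbinomial)
next
  case False
  then have "k = 0 \<or> k = 1" by auto
  then show ?thesis by auto
qed

text \<open>By \<open>gbinomial_minus_2\<close>, a prime of exponent 1 contributes \<open>-1\<close>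
  and any higher exponent makes the product vanish.\<close>

lemma divisor_prod_minus_1: "divisor_prod (-1) = moebius"
proof
  fix n
  show "divisor_prod (-1) n = moebius n"
  proof (cases "n = 0")
    case False
    let ?f = "\<lambda>p. ((of_nat (multiplicity p n) - 2 :: complex) gchoose multiplicity p n)"
    have eq: "divisor_prod (-1) n = (\<Prod>p\<in>prime_factors n. ?f p)"
      using False by (simp add: divisor_prod_def)
    show ?thesis
    proof (cases "squarefree n")
      case True
      then have "(\<Prod>p\<in>prime_factors n. ?f p) = (\<Prod>p\<in>prime_factors n. - 1)"
        using False
        by (intro prod.cong) (auto simp: gbinomial_minus_2 squarefree_factorial_semiring'
            prime_factors_multiplicity)
      then show ?thesis
        using True eq by (simp add: moebius_def)
    next
      case sq: False
      then obtain p where p: "p \<in> prime_factors n" "multiplicity p n \<noteq> 1"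
        using False by (auto simp: squarefree_factorial_semiring')
      then have "?f p = 0"
        by (auto simp: gbinomial_minus_2 prime_factors_multiplicity)
      then have "(\<Prod>p\<in>prime_factors n. ?f p) = 0"
        using p by (intro prod_zero) auto
      then show ?thesis
        using sq eq by (simp add: moebius_def)
    qed
  qed (simp add: divisor_prod_def moebius_def)
qed

text \<open>Convolution with 1 raises the parameter by one, and \<open>moebius\<close> inverts
  it.\<close>

lemma moebius_conv_divisor_prod: "moebius \<star> divisor_prod s = divisor_prod (s - 1)"
proof -
  have inv: "moebius \<star> arith_one = arith_unit"
    using arith_one_conv_divisor_prod[of "-1"]
    by (simp add: divisor_prod_minus_1 divisor_prod_0 dirichlet_conv_commute[of moebius])
  have "moebius \<star> divisor_prod s = moebius \<star> (arith_one \<star> divisor_prod (s - 1))"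
    by (simp add: arith_one_conv_divisor_prod)
  also have "\<dots> = divisor_prod (s - 1)"
    unfolding dirichlet_conv_assoc[symmetric] inv
    by (rule arith_unit_conv_left) (simp add: divisor_prod_def)
  finally show ?thesis .
qed

lemma one_conv_power_eq: "one_conv_power r = divisor_prod r"
proof -
  have "conv_power arith_one k = divisor_prod (int k)" for k
    by (induction k) (simp_all add: divisor_prod_0 arith_one_conv_divisor_prod add.commute)
  moreover have "conv_power moebius k = divisor_prod (- int k)" for k
    by (induction k) (simp_all add: divisor_prod_0 moebius_conv_divisor_prod minus_diff_commute)
  ultimately show ?thesis
    by (auto simp: one_conv_power_def)
qed

section \<open>Associated divisor functions as iterated differences\<close>

lemma assoc_divisor_fun_0: "assoc_divisor_fun 0 r = divisor_prod r"
  unfolding assoc_divisor_fun_def one_conv_power_eq conv_power.simps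
  by (rule arith_unit_conv_left) (simp add: divisor_prod_def)

text \<open>Convolving \<open>divisor_prod r\<close> with \<open>1 - e\<close> takes its forward
  difference in \<open>r\<close>; commutativity moves the extra factor next to it.\<close>

lemma assoc_divisor_fun_Suc:
  "assoc_divisor_fun (Suc j) r n = assoc_divisor_fun j (r + 1) n - assoc_divisor_fun j r n"
proof -
  let ?u = "\<lambda>n. arith_one n - arith_unit n"
  have "assoc_divisor_fun (Suc j) r = conv_power ?u j \<star> ?u \<star> divisor_prod r"
    by (simp add: assoc_divisor_fun_def one_conv_power_eq dirichlet_conv_commute[of ?u])
  also have "\<dots> = (?u \<star> divisor_prod r) \<star> conv_power ?u j"
    by (simp add: dirichlet_conv_assoc dirichlet_conv_commute[of "conv_power ?u j"])
  also have "?u \<star> divisor_prod r = (\<lambda>n. divisor_prod (r + 1) n - divisor_prod r n)"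
    by (simp add: dirichlet_conv_diff_left arith_one_conv_divisor_prod arith_unit_conv_left
        divisor_prod_def)
  finally show ?thesis
    by (simp add: dirichlet_conv_diff_left assoc_divisor_fun_def one_conv_power_eq
        dirichlet_conv_commute[of "conv_power ?u j"])
qed

lemma assoc_divisor_fun_eq_sum:
  "assoc_divisor_fun j r n =
    (\<Sum>k\<le>j. (- 1) ^ k * of_nat (j choose k) * divisor_prod (r + int j - int k) n)"
proof (induction j arbitrary: r)
  case 0
  then show ?case by (simp add: assoc_divisor_fun_0)
next
  case (Suc j)
  let ?d = "\<lambda>k. divisor_prod (r + 1 + int j - int k) n"
  \<comment> \<open>Pascal's rule splits each coefficient with \<open>k > 0\<close>.\<close>
  have "(\<Sum>k\<le>Suc j. (- 1) ^ k * of_nat (Suc j choose k) * ?d k) =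
      ?d 0 + (\<Sum>k\<le>j. (- 1) ^ Suc k * of_nat (j choose Suc k) * ?d (Suc k))
      + (\<Sum>k\<le>j. (- 1) ^ Suc k * of_nat (j choose k) * ?d (Suc k))"
    by (subst sum.atMost_Suc_shift)
       (simp add: ring_distribs sum.distrib sum_negf sum_subtractf)
  \<comment> \<open>The added top term has coefficient \<open>j choose Suc j = 0\<close>.\<close>
  also have "?d 0 + (\<Sum>k\<le>j. (- 1) ^ Suc k * of_nat (j choose Suc k) * ?d (Suc k)) =
      (\<Sum>k\<le>Suc j. (- 1) ^ k * of_nat (j choose k) * ?d k)"
    by (subst sum.atMost_Suc_shift) simp
  also have "\<dots> = assoc_divisor_fun j (r + 1) n"
    by (simp add: Suc.IH)
  \<comment> \<open>The shift of \<open>k\<close> cancels the \<open>1\<close> in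
    \<open>r + 1\<close>, so the induction hypothesis applies at \<open>r\<close> itself.\<close>
  also have "(\<Sum>k\<le>j. (- 1) ^ Suc k * of_nat (j choose k) * ?d (Suc k)) = - assoc_divisor_fun j r n"
    by (simp add: Suc.IH sum_negf algebra_simps)
  finally show ?case
    by (simp add: assoc_divisor_fun_Suc algebra_simps)
qed

section \<open>Evaluation at a given prime factorisation\<close>

lemma divisor_prod_prime_powers:
  assumes inj: "inj_on p A" and fin: "finite A"
    and pr: "\<And>l. l \<in> A \<Longrightarrow> prime (p l)" and pos: "\<And>l. l \<in> A \<Longrightarrow> a l > 0"
  shows "divisor_prod s (\<Prod>l\<in>A. p l ^ a l) = (\<Prod>l\<in>A. (of_nat (a l) + of_int s - 1) gchoose a l)"
proof -
  let ?n = "\<Prod>l\<in>A. p l ^ a l"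
  \<comment> \<open>Exponents are reindexed by the primes themselves, which injectivity of
    \<open>p\<close> permits.\<close>
  define b where "b q = a (the_inv_into A p q)" for q
  have b: "b (p l) = a l" if "l \<in> A" for l
    using that inj by (simp add: b_def the_inv_into_f_f)
  have n: "?n = (\<Prod>q\<in>p ` A. q ^ b q)"
    using inj by (simp add: prod.reindex b)
  have mult: "multiplicity q ?n = (if q \<in> p ` A then b q else 0)" if "prime q" for q
    unfolding n by (rule multiplicity_prod_prime_powers) (use fin pr that in auto)
  have "?n \<noteq> 0"
    using fin pr by (auto dest: prime_gt_0_nat)
  \<comment> \<open>Positive exponents ensure that every \<open>p l\<close> really divides
    \<open>?n\<close>.\<close>
  moreover have "prime_factors ?n = p ` A"
    using pr pos by (auto simp: prime_factors_multiplicity mult b split: if_splits)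
  ultimately have "divisor_prod s ?n = (\<Prod>l\<in>A. (of_nat (multiplicity (p l) ?n) + of_int s - 1)
      gchoose multiplicity (p l) ?n)"
    using inj by (simp add: divisor_prod_def prod.reindex)
  also have "\<dots> = (\<Prod>l\<in>A. (of_nat (a l) + of_int s - 1) gchoose a l)"
    by (rule prod.cong) (use pr in \<open>auto simp: mult b\<close>)
  finally show ?thesis .
qed

theorem theorem1:
  fixes j :: nat and r :: int
  shows "(\<forall>n>0. assoc_divisor_fun j (r + 1) n =
            assoc_divisor_fun (j + 1) r n + assoc_divisor_fun j r n) \<and>
         (\<forall>(n::nat) (\<nu>::nat) (p::nat \<Rightarrow> nat) (a::nat \<Rightarrow> nat).
            inj_on p {1..\<nu>} \<longrightarrow>
            (\<forall>l\<in>{1..\<nu>}. prime (p l) \<and> a l > 0) \<longrightarrow>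
            n = (\<Prod>l=1..\<nu>. p l ^ a l) \<longrightarrow>
            assoc_divisor_fun j r n =
              (\<Sum>k=0..j. (- 1) ^ k * of_nat (j choose k) *
                (\<Prod>l=1..\<nu>. (of_int (int (a l) + r + int j - int k - 1) :: complex) gchoose a l)))"
proof (intro conjI allI impI)
  fix n :: nat
  show "assoc_divisor_fun j (r + 1) n = assoc_divisor_fun (j + 1) r n + assoc_divisor_fun j r n"
    by (simp add: assoc_divisor_fun_Suc)
next
  fix n \<nu> :: nat and p a :: "nat \<Rightarrow> nat"
  assume "inj_on p {1..\<nu>}" and "\<forall>l\<in>{1..\<nu>}. prime (p l) \<and> a l > 0"
    and "n = (\<Prod>l=1..\<nu>. p l ^ a l)"
  then have "divisor_prod s n = (\<Prod>l=1..\<nu>. (of_nat (a l) + of_int s - 1) gchoose a l)" for s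
    using divisor_prod_prime_powers[of p "{1..\<nu>}" a s] by blast
  then show "assoc_divisor_fun j r n =
      (\<Sum>k=0..j. (- 1) ^ k * of_nat (j choose k) *
        (\<Prod>l=1..\<nu>. (of_int (int (a l) + r + int j - int k - 1) :: complex) gchoose a l))"
    by (simp add: assoc_divisor_fun_eq_sum atLeast0AtMost algebra_simps)
qed

end
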